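(* Let $D$ be the Dynkin diagram of the rank 4 hyperbolic Kac-Moody algebra $AC_{3,4}^{(1)}$: vertices $1,2,3,4$ forming a square with single edges $1-4$ and $2-3$, a double edge between $1$ and $2$ with arrow pointing toward $2$, and a double edge between $4$ and $3$ with arrow pointing toward $3$ (so $\alpha_1,\alpha_4$ are long and $\alpha_2,\alpha_3$ are short). The equivalence classes of nonempty paintings of $D$ are given by the representatives (a) $(1)$; (b) $(2)$. That is, these two paintings are inequivalent and every nonempty painting is equivalent to one of them.
   Context: A painting of a Dynkin diagram is a choice of a subset of its vertices, called painted (a Vogan diagram with trivial diagram involution). The painting whose painted vertices are exactly $i_1,\dots,i_k$ is denoted $(i_1,\dots,i_k)$. For a painted vertex $i$, the operation $F\langle i\rangle$ (reflection in the noncompact simple root $i$) changes the painting as follows: (i) the color of $i$ and of all vertices not adjacent to $i$ is unchanged; (ii) if $j$ is joined to $i$ by a double edge and $j$ is the long root, the color of $j$ is unchanged; (iii) the colors of all other vertices adjacent to $i$ are reversed. Equivalence of paintings is the equivalence relation generated by all operations $F\langle i\rangle$ ($i$ painted) and by automorphisms of the Dynkin diagram. *)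

theory Defs
  imports Main
begin

text \<open>
  A Dynkin diagram is recorded by its vertices, the number of lines joining two vertices, and its
  arrows: \<open>arrow_to D i j\<close> means that the edge between \<open>i\<close> and \<open>j\<close> carries an arrow pointing
  toward \<open>j\<close>, i.e. that the simple root of \<open>i\<close> is longer than that of \<open>j\<close>.
\<close>

record 'v dynkin_diagram =
  vertices :: "'v set"
  edge_mult :: "'v \<Rightarrow> 'v \<Rightarrow> nat"
  arrow_to :: "'v \<Rightarrow> 'v \<Rightarrow> bool"

definition adjacent :: "'v dynkin_diagram \<Rightarrow> 'v \<Rightarrow> 'v \<Rightarrow> bool" where
  "adjacent D i j \<longleftrightarrow> i \<in> vertices D \<and> j \<in> vertices D \<and> i \<noteq> j \<and> edge_mult D i j > 0"

definition diagram_automorphism :: "'v dynkin_diagram \<Rightarrow> ('v \<Rightarrow> 'v) \<Rightarrow> bool" where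
  "diagram_automorphism D f \<longleftrightarrow>
     bij_betw f (vertices D) (vertices D) \<and>
     (\<forall>i\<in>vertices D. \<forall>j\<in>vertices D.
        edge_mult D (f i) (f j) = edge_mult D i j \<and>
        (arrow_to D (f i) (f j) \<longleftrightarrow> arrow_to D i j))"

text \<open>A painting is identified with its set of painted vertices.\<close>

definition painting :: "'v dynkin_diagram \<Rightarrow> 'v set \<Rightarrow> bool" where
  "painting D P \<longleftrightarrow> P \<subseteq> vertices D"

text \<open>
  The vertices whose color is reversed by the reflection in \<open>i\<close>: all neighbors of \<open>i\<close>, except
  those joined to \<open>i\<close> by a double edge of which they are the long end.
\<close>

definition reversed_vertices :: "'v dynkin_diagram \<Rightarrow> 'v \<Rightarrow> 'v set" where
  "reversed_vertices D i =
     {j. adjacent D i j \<and> \<not> (edge_mult D i j = 2 \<and> arrow_to D j i)}"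

definition reflect_painting :: "'v dynkin_diagram \<Rightarrow> 'v \<Rightarrow> 'v set \<Rightarrow> 'v set" where
  "reflect_painting D i P =
     (P - reversed_vertices D i) \<union> (reversed_vertices D i - P)"

inductive painting_step :: "'v dynkin_diagram \<Rightarrow> 'v set \<Rightarrow> 'v set \<Rightarrow> bool"
  for D :: "'v dynkin_diagram" where
  reflection: "painting D P \<Longrightarrow> i \<in> P \<Longrightarrow> painting_step D P (reflect_painting D i P)"
| automorphism: "painting D P \<Longrightarrow> diagram_automorphism D f \<Longrightarrow> painting_step D P (f ` P)"

definition painting_equiv :: "'v dynkin_diagram \<Rightarrow> 'v set \<Rightarrow> 'v set \<Rightarrow> bool" where
  "painting_equiv D = equivclp (painting_step D)"

text \<open>The hyperbolic diagram written AC with subscript 3,4 and superscript (1); 1 and 4 are long.\<close>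

definition AC34 :: "nat dynkin_diagram" where
  "AC34 = \<lparr>
     vertices = {1, 2, 3, 4},
     edge_mult = (\<lambda>i j. if {i, j} \<in> {{1, 4}, {2, 3}} then 1
                        else if {i, j} \<in> {{1, 2}, {4, 3}} then 2
                        else 0),
     arrow_to = (\<lambda>i j. (i, j) \<in> {(1, 2), (4, 3)}) \<rparr>"

end

theory Submission
  imports Defs
begin

text \<open>
  A reflection changes the color of a long vertex only when it is the reflection in the other,
  painted, long vertex, and automorphisms permute the long vertices. Hence whether some long vertex
  is painted is an invariant; it separates the two classes. Each class is connected by reflections
  alone.
\<close>

lemma vertices_AC34: "vertices AC34 = {1, 2, 3, 4}"
  by (simp add: AC34_def)

lemma arrow_to_AC34: "arrow_to AC34 i j \<longleftrightarrow> (i, j) \<in> {(1, 2), (4, 3)}"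
  by (simp add: AC34_def)

text \<open>The double edges act one way only: 1 and 4 reverse their short neighbors, but 2 and 3
  leave their long neighbors alone. Color passes between long vertices only along the edge
  1-4.\<close>

lemma reversed_vertices_AC34:
  "reversed_vertices AC34 1 = {2, 4}"
  "reversed_vertices AC34 2 = {3}"
  "reversed_vertices AC34 3 = {2}"
  "reversed_vertices AC34 4 = {1, 3}"
  by (auto simp: reversed_vertices_def adjacent_def AC34_def doubleton_eq_iff split: if_splits)

text \<open>The long vertices are exactly the tails of arrows, and automorphisms preserve
  arrows.\<close>

lemma diagram_automorphism_AC34_long:
  assumes "diagram_automorphism AC34 f" "i \<in> vertices AC34"
  shows "f i \<in> {1, 4} \<longleftrightarrow> i \<in> {1, 4}"
proof -
  have long_iff: "k \<in> {1, 4} \<longleftrightarrow> (\<exists>j\<in>vertices AC34. arrow_to AC34 k j)" for k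
    by (auto simp: vertices_AC34 arrow_to_AC34)
  have "f ` vertices AC34 = vertices AC34"
    using assms(1) by (simp add: diagram_automorphism_def bij_betw_def)
  \<comment> \<open>By surjectivity every possible head has the form \<open>f j\<close>, so
    preservation of arrows applies to it.\<close>
  then have "(\<exists>j\<in>vertices AC34. arrow_to AC34 (f i) j) \<longleftrightarrow>
      (\<exists>j\<in>vertices AC34. arrow_to AC34 (f i) (f j))"
    by (subst (1) \<open>f ` vertices AC34 = vertices AC34\<close>[symmetric]) (rule bex_simps)
  also have "\<dots> \<longleftrightarrow> (\<exists>j\<in>vertices AC34. arrow_to AC34 i j)"
    using assms by (simp add: diagram_automorphism_def)
  finally show ?thesis
    by (simp only: long_iff)
qed

lemma painting_step_AC34_long:
  assumes "painting_step AC34 P Q"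
  shows "P \<inter> {1, 4} = {} \<longleftrightarrow> Q \<inter> {1, 4} = {}"
  using assms
proof cases
  case (reflection i)
  then consider "i = 1" | "i = 2" | "i = 3" | "i = 4"
    by (auto simp: painting_def vertices_AC34)
  then have "1 \<in> Q \<or> 4 \<in> Q \<longleftrightarrow> 1 \<in> P \<or> 4 \<in> P"
    \<comment> \<open>When \<open>i\<close> is long it stays painted itself, whatever happens to the
      other long vertex. Deleting \<open>One_nat_def\<close> keeps the literal \<open>1\<close>, so
      that \<open>reversed_vertices_AC34\<close> still matches.\<close>
    by cases (use reflection in
      \<open>simp_all add: reflect_painting_def reversed_vertices_AC34 del: One_nat_def\<close>)
  moreover have "A \<inter> {1, 4} = {} \<longleftrightarrow> \<not> (1 \<in> A \<or> 4 \<in> A)" for A :: "nat set"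
    by auto
  ultimately show ?thesis
    by (simp only:)
next
  case (automorphism f)
  then have "f i \<in> {1, 4} \<longleftrightarrow> i \<in> {1, 4}" if "i \<in> P" for i
    using that diagram_automorphism_AC34_long[of f i] by (simp add: painting_def subset_iff)
  \<comment> \<open>Long vertices go to long ones and short to short, so taking the image commutes
    with restriction to \<open>{1, 4}\<close>.\<close>
  then have "Q \<inter> {1, 4} = f ` (P \<inter> {1, 4})"
    unfolding \<open>Q = f ` P\<close> by (intro equalityI subsetI) (elim IntE imageE; simp)+
  then show ?thesis
    by simp
qed

lemma painting_equiv_AC34_long:
  assumes "painting_equiv AC34 P Q"
  shows "P \<inter> {1, 4} = {} \<longleftrightarrow> Q \<inter> {1, 4} = {}"
  using assms unfolding painting_equiv_def
  by (induction rule: equivclp_induct) (auto dest: painting_step_AC34_long)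

lemma painting_equiv_refl: "painting_equiv D P P"
  by (simp add: painting_equiv_def)

lemma painting_equiv_sym: "painting_equiv D P Q \<Longrightarrow> painting_equiv D Q P"
  by (simp add: painting_equiv_def equivclp_sym)

lemma painting_equiv_trans [trans]:
  "painting_equiv D P Q \<Longrightarrow> painting_equiv D Q R \<Longrightarrow> painting_equiv D P R"
  unfolding painting_equiv_def by (rule equivclp_trans)

lemma painting_equiv_reflect:
  assumes "painting D P" "i \<in> P" "reflect_painting D i P = Q"
  shows "painting_equiv D P Q"
  using assms painting_step.reflection unfolding painting_equiv_def by fastforce

lemma painting_equiv_AC34_no_long:
  "painting_equiv AC34 {3} {2}" "painting_equiv AC34 {2, 3} {2}"
proof -
  have "painting_equiv AC34 {2} {2, 3}"
    by (rule painting_equiv_reflect[where i = 2])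
      (auto simp: painting_def vertices_AC34 reflect_painting_def reversed_vertices_AC34)
  then show *: "painting_equiv AC34 {2, 3} {2}"
    by (rule painting_equiv_sym)
  have "painting_equiv AC34 {3} {2, 3}"
    by (rule painting_equiv_reflect[where i = 3])
      (auto simp: painting_def vertices_AC34 reflect_painting_def reversed_vertices_AC34)
  also note *
  finally show "painting_equiv AC34 {3} {2}" .
qed

text \<open>These are all eleven paintings other than \<open>{1}\<close> that meet
  \<open>{1, 4}\<close>. The proof walks a tree of reflections rooted at \<open>{1}\<close>.\<close>

lemma painting_equiv_AC34_some_long:
  "painting_equiv AC34 {1, 2, 4} {1}" "painting_equiv AC34 {1, 2, 3, 4} {1}"
  "painting_equiv AC34 {1, 3, 4} {1}" "painting_equiv AC34 {1, 3} {1}"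
  "painting_equiv AC34 {1, 2, 3} {1}" "painting_equiv AC34 {1, 2} {1}"
  "painting_equiv AC34 {1, 4} {1}" "painting_equiv AC34 {2, 3, 4} {1}"
  "painting_equiv AC34 {2, 4} {1}" "painting_equiv AC34 {3, 4} {1}"
  "painting_equiv AC34 {4} {1}"
proof -
  \<comment> \<open>One edge of the tree: \<open>P\<close> is already reached, and reflecting it in
    \<open>i\<close> reaches \<open>Q\<close>.\<close>
  have step: "painting_equiv AC34 Q {1}"
    if "painting_equiv AC34 P {1}" "i \<in> P" "P \<subseteq> {1, 2, 3, 4}" "reflect_painting AC34 i P = Q"
    for P Q i
  proof -
    have "painting_equiv AC34 P Q"
      using that by (intro painting_equiv_reflect[where i = i]) (auto simp: painting_def vertices_AC34)
    then show ?thesis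
      using that(1) painting_equiv_sym painting_equiv_trans by blast
  qed
  note simps = reflect_painting_def reversed_vertices_AC34
  show 124: "painting_equiv AC34 {1, 2, 4} {1}"
    by (rule step[OF painting_equiv_refl, of 1]) (auto simp: simps simp del: One_nat_def)
  show 1234: "painting_equiv AC34 {1, 2, 3, 4} {1}"
    by (rule step[OF 124, of 2]) (auto simp: simps simp del: One_nat_def)
  show 134: "painting_equiv AC34 {1, 3, 4} {1}"
    by (rule step[OF 1234, of 3]) (auto simp: simps simp del: One_nat_def)
  show 13: "painting_equiv AC34 {1, 3} {1}"
    by (rule step[OF 1234, of 1]) (auto simp: simps simp del: One_nat_def)
  show 123: "painting_equiv AC34 {1, 2, 3} {1}"
    by (rule step[OF 13, of 3]) (auto simp: simps simp del: One_nat_def)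
  show 12: "painting_equiv AC34 {1, 2} {1}"
    by (rule step[OF 123, of 2]) (auto simp: simps simp del: One_nat_def)
  show "painting_equiv AC34 {1, 4} {1}"
    by (rule step[OF 12, of 1]) (auto simp: simps simp del: One_nat_def)
  show 234: "painting_equiv AC34 {2, 3, 4} {1}"
    by (rule step[OF 124, of 4]) (auto simp: simps simp del: One_nat_def)
  show "painting_equiv AC34 {2, 4} {1}"
    by (rule step[OF 234, of 2]) (auto simp: simps simp del: One_nat_def)
  show "painting_equiv AC34 {3, 4} {1}"
    by (rule step[OF 234, of 3]) (auto simp: simps simp del: One_nat_def)
  show "painting_equiv AC34 {4} {1}"
    by (rule step[OF 134, of 4]) (auto simp: simps simp del: One_nat_def)
qed

theorem proposition6p7:
  "\<not> painting_equiv AC34 {1} {2} \<and>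
   (\<forall>P. painting AC34 P \<and> P \<noteq> {} \<longrightarrow>
      painting_equiv AC34 P {1} \<or> painting_equiv AC34 P {2})"
proof (intro conjI allI impI)
  show "\<not> painting_equiv AC34 {1} {2}"
    using painting_equiv_AC34_long[of "{1}" "{2}"] by auto
next
  fix P
  assume P: "painting AC34 P \<and> P \<noteq> {}"
  \<comment> \<open>Unfolding this power set lists 16 explicit sets. Their elements come in
    increasing order, as in the lemmas above, so each nonempty case matches one of those facts
    literally.\<close>
  then have "P \<in> Pow {1, 2, 3, 4}"
    by (simp add: painting_def vertices_AC34)
  then show "painting_equiv AC34 P {1} \<or> painting_equiv AC34 P {2}"
    unfolding Pow_insert Pow_empty image_insert image_empty Un_insert_left Un_empty_left
    using P
    by (elim insertE emptyE)
      (simp_all only: painting_equiv_refl painting_equiv_AC34_no_long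
        painting_equiv_AC34_some_long simp_thms)
qed

end
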